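(* The class of torsion-free monoids is globally closed. That is, if a torsion-free monoid $H$ is globally isomorphic to a semigroup $K$, then $K$ is isomorphic to a torsion-free monoid (equivalently, $K$ is a torsion-free monoid).
   Context: For a semigroup $S$ (written multiplicatively), $\mathcal P(S)$ denotes the semigroup of all non-empty subsets of $S$ under setwise multiplication $XY := \{xy : x \in X, y \in Y\}$. A semigroup $H$ is globally isomorphic to a semigroup $K$ if there is a semigroup isomorphism $\mathcal P(H) \to \mathcal P(K)$. A class $\mathscr C$ of semigroups is globally closed if, whenever a semigroup $H \in \mathscr C$ is globally isomorphic to a semigroup $K$, there exists a semigroup $K' \in \mathscr C$ that is isomorphic to $K$. The order of an element $x$ of a semigroup $S$ is the cardinality of $\{x^n : n \in \mathbb N^+\}$, where $\mathbb N^+$ is the set of positive integers. A semigroup $S$ is torsion-free if it has no elements of finite order, except for the identity element in the case that $S$ is a monoid. *)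

theory Defs
  imports "HOL-Algebra.Coset"
begin

(* HOL-Algebra has no carrier-based semigroups.  A semigroup is represented here by a monoid
   record whose field one is ignored: apart from that field of power_semigroup, no definition
   below refers to it.  The notions hom, iso and \<cong> of HOL-Algebra only use carrier
   and mult, so on such records they are the semigroup notions. *)

locale mult_semigroup =
  fixes S (structure)
  assumes mult_closed: "\<lbrakk>x \<in> carrier S; y \<in> carrier S\<rbrakk> \<Longrightarrow> x \<otimes> y \<in> carrier S"
    and mult_assoc: "\<lbrakk>x \<in> carrier S; y \<in> carrier S; z \<in> carrier S\<rbrakk>
      \<Longrightarrow> (x \<otimes> y) \<otimes> z = x \<otimes> (y \<otimes> z)"

definition is_identity :: "('a, 'm) monoid_scheme \<Rightarrow> 'a \<Rightarrow> bool" where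
  "is_identity S e \<longleftrightarrow>
     e \<in> carrier S \<and> (\<forall>x\<in>carrier S. e \<otimes>\<^bsub>S\<^esub> x = x \<and> x \<otimes>\<^bsub>S\<^esub> e = x)"

(* Only meaningful for positive exponents.  The library power x [^] n starts from the field one,
   hence is unusable in a semigroup without identity. *)
definition sg_pow :: "('a, 'm) monoid_scheme \<Rightarrow> 'a \<Rightarrow> nat \<Rightarrow> 'a" where
  "sg_pow S x n = ((\<lambda>y. y \<otimes>\<^bsub>S\<^esub> x) ^^ (n - 1)) x"

definition has_finite_order :: "('a, 'm) monoid_scheme \<Rightarrow> 'a \<Rightarrow> bool" where
  "has_finite_order S x \<longleftrightarrow> finite {sg_pow S x n | n. n \<ge> 1}"

definition torsion_free :: "('a, 'm) monoid_scheme \<Rightarrow> bool" where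
  "torsion_free S \<longleftrightarrow> (\<forall>x\<in>carrier S. has_finite_order S x \<longrightarrow> is_identity S x)"

(* set_mult is the setwise product; {\<one>} is the identity when S is a monoid. *)
definition power_semigroup :: "('a, 'm) monoid_scheme \<Rightarrow> 'a set monoid" where
  "power_semigroup S =
     \<lparr>carrier = {X. X \<subseteq> carrier S \<and> X \<noteq> {}}, mult = set_mult S, one = {\<one>\<^bsub>S\<^esub>}\<rparr>"

definition globally_isomorphic ::
    "('a, 'm) monoid_scheme \<Rightarrow> ('b, 'n) monoid_scheme \<Rightarrow> bool" where
  "globally_isomorphic H K \<longleftrightarrow> power_semigroup H \<cong> power_semigroup K"

lemma sg_pow_1: "sg_pow S x 1 = x"
  by (simp add: sg_pow_def)

lemma sg_pow_Suc: "n \<ge> 1 \<Longrightarrow> sg_pow S x (Suc n) = sg_pow S x n \<otimes>\<^bsub>S\<^esub> x"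
  by (cases n) (simp_all add: sg_pow_def)

lemma (in monoid) sg_pow_eq_nat_pow:
  assumes "x \<in> carrier G" "n \<ge> 1"
  shows "sg_pow G x n = x [^] n"
  using assms(2)
proof (induction n rule: dec_induct)
  case base
  then show ?case using assms(1) by (simp add: sg_pow_def)
next
  case (step n)
  then show ?case by (simp add: sg_pow_Suc)
qed

lemma (in mult_semigroup) mult_semigroup_power: "mult_semigroup (power_semigroup S)"
proof
  fix X Y
  assume "X \<in> carrier (power_semigroup S)" "Y \<in> carrier (power_semigroup S)"
  then show "X \<otimes>\<^bsub>power_semigroup S\<^esub> Y \<in> carrier (power_semigroup S)"
    by (auto simp: power_semigroup_def set_mult_def intro!: mult_closed)
next
  fix X Y Z
  assume "X \<in> carrier (power_semigroup S)" "Y \<in> carrier (power_semigroup S)"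
    "Z \<in> carrier (power_semigroup S)"
  then have "(x \<otimes> y) \<otimes> z = x \<otimes> (y \<otimes> z)" if "x \<in> X" "y \<in> Y" "z \<in> Z" for x y z
    using that by (intro mult_assoc) (auto simp: power_semigroup_def)
  then show "X \<otimes>\<^bsub>power_semigroup S\<^esub> Y \<otimes>\<^bsub>power_semigroup S\<^esub> Z =
      X \<otimes>\<^bsub>power_semigroup S\<^esub> (Y \<otimes>\<^bsub>power_semigroup S\<^esub> Z)"
    by (simp add: power_semigroup_def set_mult_def)
qed

end

theory Submission
  imports Defs
begin

text \<open>
  An isomorphism of power semigroups sends the identity \<open>{\<one>}\<close> to an identity of the power
  semigroup of \<open>K\<close>, any element of which is an identity of \<open>K\<close>. Let \<open>x\<close> be an element of finite
  order of \<open>K\<close>. The set \<open>C\<close> of its powers, including the identity, is a finite idempotent, and every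
  solution \<open>G\<close> of \<open>G C = C\<close> is a subset of \<open>C\<close>, so there are finitely many of them. Let \<open>Y\<close> be the
  idempotent that corresponds to \<open>C\<close>. Since \<open>{\<one>, y} Y = Y\<close> for each \<open>y\<close> in \<open>Y\<close>, the set \<open>Y\<close> is
  finite. All its elements then have finite order, hence \<open>Y = {\<one>}\<close>, \<open>C\<close> is the singleton of the
  identity, and \<open>x\<close> is the identity.
\<close>

lemma carrier_power_semigroup [simp]:
  "X \<in> carrier (power_semigroup S) \<longleftrightarrow> X \<subseteq> carrier S \<and> X \<noteq> {}"
  by (simp add: power_semigroup_def)

lemma mult_power_semigroup [simp]: "X \<otimes>\<^bsub>power_semigroup S\<^esub> Y = X <#>\<^bsub>S\<^esub> Y"
  by (simp add: power_semigroup_def)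

lemma (in monoid) is_identity_iff: "is_identity G e \<longleftrightarrow> e = \<one>"
proof
  assume "is_identity G e"
  then show "e = \<one>"
    by (metis is_identity_def l_one one_closed)
qed (simp add: is_identity_def)

text \<open>By surjectivity every element of \<open>carrier H\<close> is some
  \<open>\<phi> x\<close>, and \<open>\<phi>\<close> carries the equations
  \<open>a x = x = x a\<close> over to it.\<close>

lemma is_identity_iso:
  assumes \<phi>: "\<phi> \<in> iso G H" and a: "is_identity G a"
  shows "is_identity H (\<phi> a)"
proof -
  have hom: "\<phi> \<in> hom G H" and surj: "\<phi> ` carrier G = carrier H"
    using \<phi> by (auto simp: iso_def bij_betw_def)
  have "\<phi> a \<otimes>\<^bsub>H\<^esub> y = y \<and> y \<otimes>\<^bsub>H\<^esub> \<phi> a = y" if "y \<in> carrier H" for y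
  proof -
    have "y \<in> \<phi> ` carrier G"
      by (simp only: surj that)
    then obtain x where x: "y = \<phi> x" "x \<in> carrier G"
      by (rule imageE)
    have "a \<in> carrier G" "a \<otimes>\<^bsub>G\<^esub> x = x" "x \<otimes>\<^bsub>G\<^esub> a = x"
      using a x(2) by (simp_all add: is_identity_def)
    then show ?thesis
      using hom_mult[OF hom, of a x] hom_mult[OF hom, of x a] x by metis
  qed
  moreover have "\<phi> a \<in> carrier H"
    using a by (intro hom_in_carrier[OF hom]) (simp add: is_identity_def)
  ultimately show ?thesis
    by (simp add: is_identity_def)
qed

lemma (in monoid) is_identity_power_semigroup: "is_identity (power_semigroup G) {\<one>}"
proof -
  have "{\<one>} <#> X = (\<lambda>x. \<one> \<otimes> x) ` X" "X <#> {\<one>} = (\<lambda>x. x \<otimes> \<one>) ` X" for X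
    by (auto simp: set_mult_def)
  then show ?thesis
    by (simp add: is_identity_def subset_iff)
qed

text \<open>Testing \<open>E\<close> against a singleton \<open>{x}\<close> suffices:
  \<open>E {x} = {x} = {x} E\<close> forces the products of each element of \<open>E\<close> with
  \<open>x\<close> to be \<open>x\<close>.\<close>

lemma is_identity_from_power_semigroup:
  assumes E: "is_identity (power_semigroup S) E" and e: "e \<in> E"
  shows "is_identity S e"
proof -
  have "e \<otimes>\<^bsub>S\<^esub> x = x \<and> x \<otimes>\<^bsub>S\<^esub> e = x" if "x \<in> carrier S" for x
  proof -
    have "E <#>\<^bsub>S\<^esub> {x} = {x}" "{x} <#>\<^bsub>S\<^esub> E = {x}"
      using E that by (auto simp: is_identity_def)
    then show ?thesis
      using e by (auto simp: set_mult_def)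
  qed
  then show ?thesis
    using E e by (auto simp: is_identity_def)
qed

text \<open>Closure of \<open>Y\<close> under products keeps all positive powers of \<open>y\<close>
  inside the finite set \<open>Y\<close>.\<close>

lemma (in monoid) has_finite_order_if_mem_finite_idempotent:
  assumes Y: "finite Y" "Y \<subseteq> carrier G" "Y <#> Y = Y" and y: "y \<in> Y"
  shows "has_finite_order G y"
proof -
  have "sg_pow G y n \<in> Y" if "n \<ge> 1" for n
    using that
  proof (induction n rule: dec_induct)
    case base
    then show ?case using y by (simp add: sg_pow_def)
  next
    case (step n)
    then have "sg_pow G y (Suc n) \<in> Y <#> Y"
      using y by (auto simp: sg_pow_Suc set_mult_def)
    then show ?case using Y(3) by simp
  qed
  then show ?thesis
    unfolding has_finite_order_def by (intro finite_subset[OF _ Y(1)]) auto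
qed

text \<open>Adding exponents gives one inclusion; the exponent 0, which puts \<open>\<one>\<close>
  among the powers, gives the other.\<close>

lemma (in monoid) powers_idempotent:
  assumes "x \<in> carrier G"
  shows "range (\<lambda>n::nat. x [^] n) <#> range (\<lambda>n::nat. x [^] n) = range (\<lambda>n::nat. x [^] n)"
proof
  show "range (\<lambda>n::nat. x [^] n) <#> range (\<lambda>n::nat. x [^] n) \<subseteq> range (\<lambda>n::nat. x [^] n)"
    using assms by (auto simp: set_mult_def nat_pow_mult)
next
  have "x [^] n = x [^] n \<otimes> x [^] (0::nat)" for n :: nat
    using assms by simp
  then show "range (\<lambda>n::nat. x [^] n) \<subseteq> range (\<lambda>n::nat. x [^] n) <#> range (\<lambda>n::nat. x [^] n)"
    unfolding set_mult_def by blast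
qed

lemma (in monoid) finite_powers:
  assumes x: "x \<in> carrier G" and fin: "has_finite_order G x"
  shows "finite (range (\<lambda>n::nat. x [^] n))"
proof (rule finite_subset)
  show "range (\<lambda>n::nat. x [^] n) \<subseteq> insert \<one> {sg_pow G x n | n. n \<ge> 1}"
  proof (rule image_subsetI)
    fix n :: nat
    show "x [^] n \<in> insert \<one> {sg_pow G x n | n. n \<ge> 1}"
      using sg_pow_eq_nat_pow[OF x, of n, symmetric] by (cases "n = 0") auto
  qed
  show "finite (insert \<one> {sg_pow G x n | n. n \<ge> 1})"
    using fin by (simp add: has_finite_order_def)
qed

text \<open>The core argument, for a \<open>K\<close> whose field \<open>one\<close> is already its
  identity; the semigroup case is reduced to it.\<close>

lemma torsion_free_globally_isomorphic_monoid:
  assumes H: "monoid H" and tf: "torsion_free H" and K: "monoid K"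
    and iso: "globally_isomorphic H K"
  shows "torsion_free K"
  unfolding torsion_free_def
proof (intro ballI impI)
  interpret H: monoid H by fact
  interpret K: monoid K by fact
  fix x assume x: "x \<in> carrier K" and fin: "has_finite_order K x"
  define C where "C = range (\<lambda>n::nat. x [^]\<^bsub>K\<^esub> n)"
  obtain \<phi> where \<phi>: "\<phi> \<in> iso (power_semigroup H) (power_semigroup K)"
    using iso by (auto simp: globally_isomorphic_def is_iso_def)
  then have bij: "bij_betw \<phi> (carrier (power_semigroup H)) (carrier (power_semigroup K))"
    and hom: "\<phi> \<in> hom (power_semigroup H) (power_semigroup K)"
    by (auto simp: iso_def)
  note inj = bij_betw_imp_inj_on[OF bij]
  have mult: "\<phi> (A <#>\<^bsub>H\<^esub> B) = \<phi> A <#>\<^bsub>K\<^esub> \<phi> B"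
    if "A \<subseteq> carrier H" "A \<noteq> {}" "B \<subseteq> carrier H" "B \<noteq> {}" for A B
    using hom_mult[OF hom, of A B] that by simp
  have C: "C \<in> carrier (power_semigroup K)" "C <#>\<^bsub>K\<^esub> C = C" "finite C" "\<one>\<^bsub>K\<^esub> \<in> C"
    using x fin K.powers_idempotent K.finite_powers by (auto simp: C_def intro: range_eqI[of _ _ 0])
  have "C \<in> \<phi> ` carrier (power_semigroup H)"
    by (simp only: bij_betw_imp_surj_on[OF bij] C(1))
  then obtain Y where "C = \<phi> Y" "Y \<in> carrier (power_semigroup H)"
    by (rule imageE)
  then have Y: "Y \<subseteq> carrier H" "Y \<noteq> {}" "\<phi> Y = C"
    by simp_all
  have YY: "Y <#>\<^bsub>H\<^esub> Y = Y"
  proof (rule inj_onD[OF inj])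
    show "\<phi> (Y <#>\<^bsub>H\<^esub> Y) = \<phi> Y"
      using mult[of Y Y] Y C(2) by simp
    show "Y <#>\<^bsub>H\<^esub> Y \<in> carrier (power_semigroup H)" "Y \<in> carrier (power_semigroup H)"
      using Y by (auto simp: set_mult_def)
  qed
  have "\<phi> {\<one>\<^bsub>H\<^esub>, y} \<subseteq> C" if y: "y \<in> Y" for y
  proof -
    have "{\<one>\<^bsub>H\<^esub>, y} <#>\<^bsub>H\<^esub> Y = (\<lambda>z. \<one>\<^bsub>H\<^esub> \<otimes>\<^bsub>H\<^esub> z) ` Y \<union> (\<lambda>z. y \<otimes>\<^bsub>H\<^esub> z) ` Y"
      by (auto simp: set_mult_def)
    also have "(\<lambda>z. \<one>\<^bsub>H\<^esub> \<otimes>\<^bsub>H\<^esub> z) ` Y = Y"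
      using Y(1) by (simp add: subset_iff)
    also have "Y \<union> (\<lambda>z. y \<otimes>\<^bsub>H\<^esub> z) ` Y = Y"
    proof -
      have "(\<lambda>z. y \<otimes>\<^bsub>H\<^esub> z) ` Y \<subseteq> Y <#>\<^bsub>H\<^esub> Y"
        using y by (auto simp: set_mult_def)
      then show ?thesis
        unfolding YY by blast
    qed
    finally have "\<phi> {\<one>\<^bsub>H\<^esub>, y} <#>\<^bsub>K\<^esub> C = C"
      using mult[of "{\<one>\<^bsub>H\<^esub>, y}" Y] Y y by (simp add: subset_iff)
    moreover have "\<phi> {\<one>\<^bsub>H\<^esub>, y} \<subseteq> carrier K"
      using hom_in_carrier[OF hom, of "{\<one>\<^bsub>H\<^esub>, y}"] Y y by auto
    \<comment> \<open>Since \<open>C\<close> contains the identity, \<open>D\<close> is a subset of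
      \<open>D C\<close>; for \<open>D = \<phi> {\<one>, y}\<close> this product is
      \<open>C\<close>.\<close>
    moreover have "k \<in> D <#>\<^bsub>K\<^esub> C" if "k \<in> D" "D \<subseteq> carrier K" for k D
    proof -
      have "k = k \<otimes>\<^bsub>K\<^esub> \<one>\<^bsub>K\<^esub>"
        using that by auto
      then show ?thesis
        using that(1) C(4) unfolding set_mult_def by blast
    qed
    ultimately show ?thesis
      by blast
  qed
  \<comment> \<open>The pair \<open>{\<one>, y}\<close> determines \<open>y\<close>, also when
    \<open>y = \<one>\<close>, so \<open>Y\<close> embeds into the finite set
    \<open>Pow C\<close>.\<close>
  moreover have "inj_on (\<lambda>y. \<phi> {\<one>\<^bsub>H\<^esub>, y}) Y"
  proof (rule inj_onI)
    fix y z assume "y \<in> Y" "z \<in> Y" "\<phi> {\<one>\<^bsub>H\<^esub>, y} = \<phi> {\<one>\<^bsub>H\<^esub>, z}"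
    then have "{\<one>\<^bsub>H\<^esub>, y} = {\<one>\<^bsub>H\<^esub>, z}"
      using Y(1) by (intro inj_onD[OF inj]) auto
    then show "y = z"
      by (metis doubleton_eq_iff)
  qed
  ultimately have "finite Y"
    using C(3) by (intro inj_on_finite[of _ Y "Pow C"]) auto
  then have "y = \<one>\<^bsub>H\<^esub>" if "y \<in> Y" for y
    using H.has_finite_order_if_mem_finite_idempotent[OF _ Y(1) YY that] tf that Y(1)
    by (auto simp: torsion_free_def H.is_identity_iff)
  then have "Y = {\<one>\<^bsub>H\<^esub>}"
    using Y(2) by blast
  \<comment> \<open>Now \<open>C\<close> is the image of the identity \<open>{\<one>}\<close>, so
    each of its elements, \<open>x\<close> among them, is an identity of \<open>K\<close>.\<close>
  then have "is_identity (power_semigroup K) C"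
    using is_identity_iso[OF \<phi> H.is_identity_power_semigroup] Y(3) by simp
  moreover have "x \<in> C"
    using x unfolding C_def by (intro range_eqI[of _ _ 1]) simp
  ultimately show "is_identity K x"
    by (rule is_identity_from_power_semigroup)
qed

theorem theorem3p3:
  fixes H :: "('a, 'm) monoid_scheme" and K :: "('b, 'n) monoid_scheme"
  assumes "monoid H" and "torsion_free H"
    and "mult_semigroup K"
    and "globally_isomorphic H K"
  shows "(\<exists>K' :: 'b monoid. monoid K' \<and> torsion_free K' \<and> K' \<cong> K) \<and>
         (\<exists>e. is_identity K e) \<and> torsion_free K"
proof -
  interpret H: monoid H by fact
  interpret K: mult_semigroup K by fact
  obtain \<phi> where \<phi>: "\<phi> \<in> iso (power_semigroup H) (power_semigroup K)"
    using assms(4) by (auto simp: globally_isomorphic_def is_iso_def)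
  have E: "is_identity (power_semigroup K) (\<phi> {\<one>\<^bsub>H\<^esub>})"
    using is_identity_iso[OF \<phi> H.is_identity_power_semigroup] .
  then obtain e where e: "is_identity K e"
    using is_identity_from_power_semigroup[OF E] by (auto simp: is_identity_def)
  \<comment> \<open>The field \<open>one\<close> of \<open>K\<close> is arbitrary; \<open>K'\<close>
    is the same semigroup with the identity \<open>e\<close> stored there.\<close>
  define K' :: "'b monoid" where "K' = \<lparr>carrier = carrier K, mult = mult K, one = e\<rparr>"
  have K' [simp]: "carrier K' = carrier K" "mult K' = mult K" "\<one>\<^bsub>K'\<^esub> = e"
    by (simp_all add: K'_def)
  have mon: "monoid K'"
    using e by unfold_locales (auto simp: is_identity_def K.mult_closed K.mult_assoc)
  \<comment> \<open>The power semigroups of \<open>K\<close> and \<open>K'\<close> can differ only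
    in the field \<open>one\<close>, which isomorphisms ignore.\<close>
  have "set_mult K' = set_mult K"
    by (intro ext) (simp add: set_mult_def)
  then have "globally_isomorphic H K'"
    using assms(4)
    by (simp add: globally_isomorphic_def is_iso_def iso_def hom_def power_semigroup_def)
  then have tf: "torsion_free K'"
    using torsion_free_globally_isomorphic_monoid assms(1,2) mon by blast
  then have "torsion_free K"
    by (simp add: torsion_free_def has_finite_order_def sg_pow_def is_identity_def)
  moreover have "(\<lambda>x. x) \<in> iso K' K"
    by (auto simp: iso_def hom_def K.mult_closed bij_betw_def)
  then have "K' \<cong> K"
    by (auto simp: is_iso_def)
  ultimately show ?thesis
    using mon tf e by blast
qed

end
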